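(* Let $n$ be an odd positive integer and let $R_n$ be the dihedral quandle of order $n$. Then $\Delta^k(R_n)/\Delta^{k+1}(R_n)\cong\mathbb{Z}_n$ (as abelian groups) for all $k\geq 1$.
   Context: The dihedral quandle $R_n$ is the set $\{a_0,a_1,\dots,a_{n-1}\}$ with $a_i\triangleright a_j=a_{2j-i}$ (indices mod $n$). Its integral quandle ring $\mathbb{Z}[R_n]$ is the free abelian group on $R_n$ with the (generally nonassociative) multiplication $\left(\sum_i\alpha_i a_i\right)\cdot\left(\sum_j\beta_j a_j\right)=\sum_{i,j}\alpha_i\beta_j\,(a_i\triangleright a_j)$. The augmentation ideal $\Delta(R_n)$ is the kernel of the map $\mathbb{Z}[R_n]\to\mathbb{Z}$, $\sum_i\alpha_i a_i\mapsto\sum_i\alpha_i$; it is the free abelian group with basis $a_i-a_0$, $1\le i\le n-1$. Its powers are $\Delta^1(R_n)=\Delta(R_n)$ and $\Delta^{k+1}(R_n)=$ the additive subgroup generated by all products $u\cdot v$ with $u\in\Delta(R_n)$, $v\in\Delta^k(R_n)$. $\mathbb{Z}_n=\mathbb{Z}/n\mathbb{Z}$. *)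

theory Defs
  imports "HOL-Algebra.Free_Abelian_Groups"
begin

record 'a quandle_struct = "'a partial_object" +
  qop :: "'a \<Rightarrow> 'a \<Rightarrow> 'a" (infixl "\<triangleright>\<index>" 70)

text \<open>The element \<open>a\<^sub>i\<close> of the dihedral quandle is represented by the residue \<open>i\<close>
  in \<open>{0..<n}\<close>.\<close>

definition dihedral_quandle :: "nat \<Rightarrow> int quandle_struct" where
  "dihedral_quandle n = \<lparr>carrier = {0..<int n}, qop = (\<lambda>i j. (2 * j - i) mod int n)\<rparr>"

text \<open>The additive group of the integral quandle ring of \<open>Q\<close> is
  \<^term>\<open>free_Abelian_group (carrier Q)\<close>; its multiplication extends the quandle operation
  bilinearly. It is in general neither associative nor unital, so it is kept separate from the
  ring structures of the library.\<close>

definition qring_mult ::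
    "('a, 'm) quandle_struct_scheme \<Rightarrow> ('a \<Rightarrow>\<^sub>0 int) \<Rightarrow> ('a \<Rightarrow>\<^sub>0 int) \<Rightarrow> ('a \<Rightarrow>\<^sub>0 int)" where
  "qring_mult Q u v =
     (\<Sum>x\<in>Poly_Mapping.keys u. \<Sum>y\<in>Poly_Mapping.keys v.
        frag_cmul (Poly_Mapping.lookup u x * Poly_Mapping.lookup v y) (frag_of (x \<triangleright>\<^bsub>Q\<^esub> y)))"

definition augmentation :: "('a \<Rightarrow>\<^sub>0 int) \<Rightarrow> int" where
  "augmentation u = (\<Sum>x\<in>Poly_Mapping.keys u. Poly_Mapping.lookup u x)"

definition aug_ideal :: "('a, 'm) quandle_struct_scheme \<Rightarrow> ('a \<Rightarrow>\<^sub>0 int) set" where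
  "aug_ideal Q = kernel (free_Abelian_group (carrier Q)) integer_group augmentation"

text \<open>Powers are right-nested: the new factor is multiplied from the left. The powers of interest
  start at exponent \<open>1\<close>; the value at \<open>0\<close> is only a convention and does not enter the recursion.\<close>

fun aug_power :: "('a, 'm) quandle_struct_scheme \<Rightarrow> nat \<Rightarrow> ('a \<Rightarrow>\<^sub>0 int) set" where
  "aug_power Q 0 = carrier (free_Abelian_group (carrier Q))"
| "aug_power Q (Suc 0) = aug_ideal Q"
| "aug_power Q (Suc (Suc k)) =
     generate (free_Abelian_group (carrier Q))
       {qring_mult Q u v | u v. u \<in> aug_ideal Q \<and> v \<in> aug_power Q (Suc k)}"

definition aug_quotient ::
    "('a, 'm) quandle_struct_scheme \<Rightarrow> nat \<Rightarrow> ('a \<Rightarrow>\<^sub>0 int) set monoid" where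
  "aug_quotient Q k =
     (free_Abelian_group (carrier Q))\<lparr>carrier := aug_power Q k\<rparr> Mod aug_power Q (Suc k)"

end

(*
  Identify the additive group of the quandle ring with Z[X]/(X^n - 1) via a_i = X^i. The quandle
  product of f and g is then f(X^(n-1)) * g(X^2). Both substitutions preserve the augmentation
  ideal (X - 1), and for odd n they are automorphisms of the quotient ring, so the k-th power of
  the augmentation ideal is (X - 1)^k. The map (X - 1)^k f |-> f(1) mod n on it is well defined
  with kernel (X - 1)^(k+1): if X^n - 1 divides (X - 1)^k f with k > 0, then f is a multiple of
  1 + X + ... + X^(n-1), whose value at 1 is n.
*)

theory Submission
  imports Defs "HOL-Computational_Algebra.Polynomial"
begin

abbreviation X :: "int poly" where "X \<equiv> [:0, 1:]"

section \<open>Polynomial induction, substitution and congruences\<close>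

text \<open>A polynomial is a finite sum of monomials, so claims additive in \<open>p\<close> reduce
  to a single power of the variable. The zero polynomial is the case \<open>c = 0\<close>.\<close>

lemma additive_monom_induct:
  fixes p :: "'a::comm_semiring_1 poly"
  assumes monom: "\<And>c i. P (smult c ([:0, 1:] ^ i))"
    and add: "\<And>p q. P p \<Longrightarrow> P q \<Longrightarrow> P (p + q)"
  shows "P p"
proof -
  have "P 0" using monom[of 0 0] by simp
  have "P (\<Sum>i\<in>A. monom (coeff p i) i)" if "finite A" for A
    using that by induction (auto simp: \<open>P 0\<close> monom_altdef intro: monom add)
  from this[of "{..degree p}"] show ?thesis
    by (simp add: poly_as_sum_of_monoms)
qed

lemma pcompose_power: "pcompose (p ^ k) q = pcompose p q ^ k"
  for p q :: "'a::comm_semiring_1 poly"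
  by (induction k) (simp_all add: pcompose_1 pcompose_mult)

lemma pcompose_X: "pcompose [:0, 1:] q = q"
  for q :: "'a::comm_semiring_1 poly"
  by (simp add: pcompose_pCons)

text \<open>Horner's scheme carries a congruence of arguments over to values. This later replaces
  \<open>(X ^ 2) ^ m\<close> by \<open>X\<close> inside a substitution.\<close>

lemma diff_dvd_pcompose_diff: "q - r dvd pcompose p q - pcompose p r"
  for p q r :: "'a::comm_ring_1 poly"
proof (induction p)
  case (pCons a p)
  have "pcompose (pCons a p) q - pcompose (pCons a p) r
      = q * (pcompose p q - pcompose p r) + (q - r) * pcompose p r"
    by (simp add: pcompose_pCons algebra_simps)
  with pCons show ?case by simp
qed simp

lemma diff_one_dvd_power_diff_one: "x - 1 dvd x ^ k - 1"
  for x :: "'a::comm_ring_1"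
  by (metis dvd_triv_left power_diff_1_eq)

lemma dvd_mult_diff: "d dvd a - a' \<Longrightarrow> d dvd b - b' \<Longrightarrow> d dvd a * b - a' * b'"
  for a b d :: "'a::comm_ring_1"
proof -
  assume "d dvd a - a'" "d dvd b - b'"
  then have "d dvd (a - a') * b + a' * (b - b')" by simp
  then show ?thesis by (simp add: algebra_simps)
qed

lemma dvd_power_diff: "d dvd a - b \<Longrightarrow> d dvd a ^ k - b ^ k"
  for a b d :: "'a::comm_ring_1"
  by (induction k) (simp_all add: dvd_mult_diff)

lemma dvd_diff_trans: "d dvd a - b \<Longrightarrow> d dvd b - c \<Longrightarrow> d dvd a - c"
  for a b c d :: "'a::comm_ring_1"
  by (drule (1) dvd_add) simp

lemma poly_1_eq_0_iff: "poly p 1 = 0 \<longleftrightarrow> X - 1 dvd p"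
  by (simp add: poly_eq_0_iff_dvd one_pCons)

section \<open>Additivity of the augmentation and bilinearity of the product\<close>

lemma augmentation_eq_sum:
  "finite A \<Longrightarrow> Poly_Mapping.keys u \<subseteq> A \<Longrightarrow> augmentation u = (\<Sum>x\<in>A. Poly_Mapping.lookup u x)"
  unfolding augmentation_def by (rule sum.mono_neutral_left) (auto simp: in_keys_iff)

lemma augmentation_add: "augmentation (u + v) = augmentation u + augmentation v"
  using augmentation_eq_sum[of "Poly_Mapping.keys u \<union> Poly_Mapping.keys v"] keys_add[of u v]
  by (simp add: lookup_add sum.distrib)

lemma augmentation_cmul_of: "augmentation (frag_cmul c (frag_of x)) = c"
  using augmentation_eq_sum[of "{x}" "frag_cmul c (frag_of x)"] keys_cmul[of c "frag_of x"] by simp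

lemma qring_mult_eq_frag_extend:
  "qring_mult Q u v = frag_extend (\<lambda>x. frag_extend (\<lambda>y. frag_of (x \<triangleright>\<^bsub>Q\<^esub> y)) v) u"
  by (simp add: qring_mult_def frag_extend_def frag_cmul_sum)

lemma qring_mult_add_left: "qring_mult Q (u + u') v = qring_mult Q u v + qring_mult Q u' v"
  by (simp add: qring_mult_eq_frag_extend frag_extend_add)

lemma qring_mult_add_right: "qring_mult Q u (v + v') = qring_mult Q u v + qring_mult Q u v'"
  by (simp add: qring_mult_eq_frag_extend frag_extend_add)
    (simp add: frag_extend_def frag_cmul_distrib2 sum.distrib)

lemma qring_mult_cmul_of:
  "qring_mult Q (frag_cmul c (frag_of x)) (frag_cmul d (frag_of y))
    = frag_cmul (c * d) (frag_of (x \<triangleright>\<^bsub>Q\<^esub> y))"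
  by (simp add: qring_mult_eq_frag_extend frag_extend_cmul)

section \<open>The quandle ring as polynomials modulo \<open>X ^ n - 1\<close>\<close>

text \<open>\<open>of_poly n\<close> sends \<open>X\<^sup>i\<close> to \<open>a\<^sub>i\<close> and induces an isomorphism of the additive group of
  \<open>\<int>[X]/(X\<^sup>n - 1)\<close> with that of the quandle ring.\<close>

definition of_poly :: "nat \<Rightarrow> int poly \<Rightarrow> int \<Rightarrow>\<^sub>0 int" where
  "of_poly n p = (\<Sum>i\<le>degree p. frag_cmul (coeff p i) (frag_of (int (i mod n))))"

definition to_poly :: "(int \<Rightarrow>\<^sub>0 int) \<Rightarrow> int poly" where
  "to_poly u = (\<Sum>x\<in>Poly_Mapping.keys u. smult (Poly_Mapping.lookup u x) (X ^ nat x))"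

lemma of_poly_eq_sum:
  "degree p \<le> m \<Longrightarrow> of_poly n p = (\<Sum>i\<le>m. frag_cmul (coeff p i) (frag_of (int (i mod n))))"
  unfolding of_poly_def by (rule sum.mono_neutral_left) (auto simp: coeff_eq_0)

lemma of_poly_add: "of_poly n (p + q) = of_poly n p + of_poly n q"
  using of_poly_eq_sum[of _ "max (degree p) (degree q)" n] degree_add_le_max[of p q]
  by (simp add: frag_cmul_distrib sum.distrib)

lemma of_poly_0 [simp]: "of_poly n 0 = 0"
  by (simp add: of_poly_def)

lemma of_poly_minus: "of_poly n (- p) = - of_poly n p"
  by (metis add.right_inverse neg_eq_iff_add_eq_0 of_poly_0 of_poly_add)

lemma of_poly_diff: "of_poly n (p - q) = of_poly n p - of_poly n q"
  by (metis diff_conv_add_uminus of_poly_add of_poly_minus)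

lemma of_poly_sum: "of_poly n (sum f A) = (\<Sum>x\<in>A. of_poly n (f x))"
  by (induction A rule: infinite_finite_induct) (simp_all add: of_poly_add)

lemma of_poly_smult_power:
  "of_poly n (smult c (X ^ i)) = frag_cmul c (frag_of (int (i mod n)))"
proof -
  have "smult c (X ^ i) = monom c i" by (simp add: monom_altdef)
  moreover have "of_poly n (monom c i)
      = (\<Sum>j\<le>i. frag_cmul (coeff (monom c i) j) (frag_of (int (j mod n))))"
    by (rule of_poly_eq_sum) (simp add: degree_monom_le)
  moreover have "\<dots> = (\<Sum>j\<in>{i}. frag_cmul (coeff (monom c i) j) (frag_of (int (j mod n))))"
    by (rule sum.mono_neutral_right) auto
  ultimately show ?thesis by simp
qed

lemma augmentation_of_poly: "augmentation (of_poly n p) = poly p 1"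
  by (induction p rule: additive_monom_induct)
    (simp_all add: of_poly_smult_power augmentation_cmul_of of_poly_add augmentation_add)

lemma to_poly_eq_sum:
  "finite A \<Longrightarrow> Poly_Mapping.keys u \<subseteq> A \<Longrightarrow>
    to_poly u = (\<Sum>x\<in>A. smult (Poly_Mapping.lookup u x) (X ^ nat x))"
  unfolding to_poly_def by (rule sum.mono_neutral_left) (auto simp: in_keys_iff)

lemma to_poly_0 [simp]: "to_poly 0 = 0"
  by (simp add: to_poly_def)

lemma to_poly_add: "to_poly (u + v) = to_poly u + to_poly v"
  using to_poly_eq_sum[of "Poly_Mapping.keys u \<union> Poly_Mapping.keys v"] keys_add[of u v]
  by (simp add: lookup_add smult_add_left sum.distrib)

lemma to_poly_cmul_of: "to_poly (frag_cmul c (frag_of x)) = smult c (X ^ nat x)"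
  using to_poly_eq_sum[of "{x}" "frag_cmul c (frag_of x)"] keys_cmul[of c "frag_of x"] by simp

lemma dvd_power_mod_diff: "X ^ n - 1 dvd X ^ (i mod n) - X ^ i"
proof -
  have "X ^ i = X ^ (i mod n) * (X ^ n) ^ (i div n)"
    by (metis mod_mult_div_eq power_add power_mult)
  then have "X ^ (i mod n) - X ^ i = - (X ^ (i mod n)) * ((X ^ n) ^ (i div n) - 1)"
    by (simp add: algebra_simps)
  then show ?thesis
    using diff_one_dvd_power_diff_one[of "X ^ n" "i div n"] by simp
qed

text \<open>Reducing exponents modulo \<open>n\<close> changes a polynomial only by multiples of
  \<open>X ^ n - 1\<close>. Hence the kernel of \<open>of_poly n\<close> is no larger than the ideal
  these form.\<close>

lemma dvd_to_poly_of_poly_diff: "X ^ n - 1 dvd to_poly (of_poly n p) - p"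
proof (induction p rule: additive_monom_induct)
  case (1 c i)
  then show ?case
    using dvd_power_mod_diff[of n i]
    by (simp add: of_poly_smult_power to_poly_cmul_of dvd_smult flip: smult_diff_right)
next
  case (2 p q)
  then have "X ^ n - 1 dvd (to_poly (of_poly n p) - p) + (to_poly (of_poly n q) - q)"
    by (rule dvd_add)
  then show ?case
    by (simp add: of_poly_add to_poly_add algebra_simps)
qed

lemma of_poly_mult_eq_0: "of_poly n ((X ^ n - 1) * p) = 0"
proof (induction p rule: additive_monom_induct)
  case (1 c i)
  have "(X ^ n - 1) * smult c (X ^ i) = smult c (X ^ (n + i)) - smult c (X ^ i)"
    by (simp add: algebra_simps power_add smult_diff_right)
  then show ?case
    by (simp only: of_poly_diff of_poly_smult_power) simp
qed (simp add: distrib_left of_poly_add)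

lemma of_poly_eq_0_iff: "of_poly n p = 0 \<longleftrightarrow> X ^ n - 1 dvd p"
proof
  assume "of_poly n p = 0"
  then show "X ^ n - 1 dvd p"
    using dvd_to_poly_of_poly_diff[of n p] by simp
qed (auto simp: of_poly_mult_eq_0)

lemma of_poly_eq_iff: "of_poly n p = of_poly n q \<longleftrightarrow> X ^ n - 1 dvd p - q"
  by (simp flip: of_poly_eq_0_iff add: of_poly_diff)

lemma of_poly_to_poly:
  assumes "Poly_Mapping.keys u \<subseteq> {0..<int n}"
  shows "of_poly n (to_poly u) = u"
proof -
  have "of_poly n (to_poly u)
      = (\<Sum>x\<in>Poly_Mapping.keys u. frag_cmul (Poly_Mapping.lookup u x) (frag_of x))"
    unfolding to_poly_def of_poly_sum of_poly_smult_power
    using assms by (intro sum.cong refl) (auto simp: subset_iff)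
  also have "\<dots> = u"
    by (metis frag_expansion frag_extend_def)
  finally show ?thesis .
qed

lemma keys_of_poly: "0 < n \<Longrightarrow> Poly_Mapping.keys (of_poly n p) \<subseteq> {0..<int n}"
proof (induction p rule: additive_monom_induct)
  case (2 p q)
  then show ?case
    using keys_add[of "of_poly n p" "of_poly n q"] by (auto simp: of_poly_add)
qed (auto simp: of_poly_smult_power)

text \<open>Inversion of indices and doubling become the substitutions \<open>X \<mapsto> X\<^sup>n\<^sup>-\<^sup>1\<close> and
  \<open>X \<mapsto> X\<^sup>2\<close>, so the nonassociative product is a twist of the commutative polynomial product.\<close>

lemma qring_mult_of_poly:
  assumes "0 < n"
  shows "qring_mult (dihedral_quandle n) (of_poly n p) (of_poly n q)
    = of_poly n (pcompose p (X ^ (n - 1)) * pcompose q (X ^ 2))"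
proof (induction p rule: additive_monom_induct)
  case (1 c i)
  show ?case
  proof (induction q rule: additive_monom_induct)
    case (1 d j)
    have "(2 * (int j mod int n) - int i mod int n) mod int n = (2 * int j - int i) mod int n"
      by (metis mod_diff_cong mod_mod_trivial mod_mult_right_eq)
    \<comment> \<open>Adding \<open>n * i\<close> turns the negative index \<open>- i\<close> into
      the exponent \<open>(n - 1) * i\<close>.\<close>
    also have "\<dots> = (2 * int j - int i + int n * int i) mod int n"
      by simp
    also have "\<dots> = int (((n - 1) * i + 2 * j) mod n)"
      using assms by (cases n) (simp_all add: zmod_int algebra_simps)
    finally show ?case
      by (simp add: of_poly_smult_power qring_mult_cmul_of pcompose_smult pcompose_power pcompose_pCons
          mult.commute[of d c] dihedral_quandle_def zmod_int
          flip: power_mult power_add)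
  qed (simp add: of_poly_add qring_mult_add_right pcompose_add distrib_left)
qed (simp add: of_poly_add qring_mult_add_left pcompose_add distrib_right)

section \<open>Powers of the augmentation ideal as powers of \<open>X - 1\<close>\<close>

text \<open>The image in the quandle ring of the polynomial ideal generated by
  \<open>(X - 1) ^ k\<close>.\<close>

definition cyc_power :: "nat \<Rightarrow> nat \<Rightarrow> (int \<Rightarrow>\<^sub>0 int) set" where
  "cyc_power n k = range (\<lambda>f. of_poly n ((X - 1) ^ k * f))"

lemma of_poly_in_cyc_power: "of_poly n ((X - 1) ^ k * f) \<in> cyc_power n k"
  unfolding cyc_power_def by (rule rangeI)

lemma carrier_dihedral [simp]: "carrier (dihedral_quandle n) = {0..<int n}"
  by (simp add: dihedral_quandle_def)

lemma subgroup_cyc_power: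
  assumes "0 < n"
  shows "subgroup (cyc_power n k) (free_Abelian_group {0..<int n})"
proof (rule group.subgroupI[OF group_free_Abelian_group])
  show "cyc_power n k \<subseteq> carrier (free_Abelian_group {0..<int n})"
    using keys_of_poly[OF assms] by (auto simp: cyc_power_def)
  show "cyc_power n k \<noteq> {}" by (simp add: cyc_power_def)
next
  fix a assume "a \<in> cyc_power n k"
  then obtain f where f: "a = of_poly n ((X - 1) ^ k * f)" by (auto simp: cyc_power_def)
  have "- a = of_poly n ((X - 1) ^ k * (- f))" by (simp add: f of_poly_minus)
  then show "inv\<^bsub>free_Abelian_group {0..<int n}\<^esub> a \<in> cyc_power n k"
    using keys_of_poly[OF assms] f unfolding cyc_power_def by (metis inv_free_Abelian_group rangeI)
next
  fix a b assume "a \<in> cyc_power n k" "b \<in> cyc_power n k"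
  then show "a \<otimes>\<^bsub>free_Abelian_group {0..<int n}\<^esub> b \<in> cyc_power n k"
    by (auto simp: cyc_power_def simp flip: of_poly_add distrib_left)
qed

text \<open>Augmentation is evaluation at 1, so the factor theorem supplies the factor
  \<open>X - 1\<close>.\<close>

lemma aug_ideal_dihedral:
  assumes "0 < n"
  shows "aug_ideal (dihedral_quandle n) = cyc_power n 1"
proof (intro equalityI subsetI)
  fix u assume "u \<in> aug_ideal (dihedral_quandle n)"
  then have u: "Poly_Mapping.keys u \<subseteq> {0..<int n}" and "augmentation u = 0"
    by (auto simp: aug_ideal_def kernel_def integer_group_def)
  then have "poly (to_poly u) 1 = 0"
    by (metis augmentation_of_poly of_poly_to_poly)
  then obtain f where "to_poly u = (X - 1) * f"
    unfolding poly_1_eq_0_iff by (elim dvdE)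
  then have "u = of_poly n ((X - 1) * f)"
    using of_poly_to_poly[OF u] by simp
  then show "u \<in> cyc_power n 1" by (simp add: cyc_power_def)
next
  fix u assume "u \<in> cyc_power n 1"
  then show "u \<in> aug_ideal (dihedral_quandle n)"
    using keys_of_poly[OF assms]
    by (auto simp: cyc_power_def aug_ideal_def kernel_def integer_group_def augmentation_of_poly)
qed

text \<open>Both substitutions send \<open>X - 1\<close> to a multiple of itself, so the left factor
  contributes one power of \<open>X - 1\<close> and the right factor contributes
  \<open>k\<close>.\<close>

lemma qring_mult_cyc_power:
  assumes "0 < n" "u \<in> cyc_power n 1" "v \<in> cyc_power n k"
  shows "qring_mult (dihedral_quandle n) u v \<in> cyc_power n (Suc k)"
proof -
  obtain f g where u: "u = of_poly n ((X - 1) * f)" and v: "v = of_poly n ((X - 1) ^ k * g)"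
    using assms by (auto simp: cyc_power_def)
  obtain a where a: "X ^ (n - 1) - 1 = (X - 1) * a"
    using diff_one_dvd_power_diff_one[of X] by blast
  have "pcompose ((X - 1) * f) (X ^ (n - 1)) * pcompose ((X - 1) ^ k * g) (X ^ 2)
      = (X ^ (n - 1) - 1) * pcompose f (X ^ (n - 1)) * ((X ^ 2 - 1) ^ k * pcompose g (X ^ 2))"
    by (simp add: pcompose_mult pcompose_power pcompose_diff pcompose_pCons pcompose_1)
  moreover have "X ^ 2 - 1 = (X - 1) * (X + 1)"
    by (simp add: algebra_simps power2_eq_square)
  ultimately have "pcompose ((X - 1) * f) (X ^ (n - 1)) * pcompose ((X - 1) ^ k * g) (X ^ 2)
      = (X - 1) ^ Suc k * (a * pcompose f (X ^ (n - 1)) * ((X + 1) ^ k * pcompose g (X ^ 2)))"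
    by (simp only: a power_mult_distrib power_Suc ac_simps)
  then show ?thesis
    by (simp only: u v qring_mult_of_poly[OF assms(1)] cyc_power_def) blast
qed

text \<open>For odd \<open>n = 2m - 1\<close> the square \<open>X\<^sup>2\<close> is again a generator of the cyclic group, because
  \<open>X\<^sup>2\<^sup>m \<equiv> X\<close>. Hence \<open>X - 1\<close> is a multiple of \<open>X\<^sup>2 - 1\<close> and every polynomial is congruent to
  a polynomial in \<open>X\<^sup>2\<close>.\<close>

lemma cyc_power_Suc_product:
  assumes "odd n" "w \<in> cyc_power n (Suc k)"
  obtains u v where "u \<in> cyc_power n 1" "v \<in> cyc_power n k"
    "w = qring_mult (dihedral_quandle n) u v"
proof -
  obtain f where w: "w = of_poly n ((X - 1) ^ Suc k * f)"
    using assms by (auto simp: cyc_power_def)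
  have "0 < n" using assms(1) by (simp add: odd_pos)
  \<comment> \<open>\<open>m\<close> is the inverse of 2 modulo \<open>n\<close>.\<close>
  obtain m where m: "2 * m = Suc n"
    using assms(1) by (metis evenE even_Suc)
  \<comment> \<open>\<open>E\<close> is \<open>(X ^ m - 1) / (X - 1)\<close>. After squaring the
    variable, \<open>E2\<close> turns \<open>X ^ 2 - 1\<close> into \<open>X ^ (2 * m) - 1\<close>,
    which is congruent to \<open>X - 1\<close>.\<close>
  define E where "E = (\<Sum>j<m. X ^ j)"
  define E2 where "E2 = pcompose E (X ^ 2)"
  \<comment> \<open>The left factor will be \<open>X - 1\<close>, which becomes
    \<open>X ^ (n - 1) - 1\<close>. Multiplying that by \<open>- X\<close> gives
    \<open>X - 1\<close> modulo \<open>?N\<close>.\<close>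
  define h where "h = - X * f"
  \<comment> \<open>Substituting \<open>X ^ 2\<close> turns \<open>pcompose h (X ^ m)\<close> into a
    polynomial congruent to \<open>h\<close>, while \<open>E ^ k\<close> corrects the factor
    \<open>(X ^ 2 - 1) ^ k\<close>.\<close>
  define g where "g = E ^ k * pcompose h (X ^ m)"
  let ?N = "X ^ n - 1"
  have X2: "(X ^ 2) ^ m = X ^ Suc n"
    by (simp only: m flip: power_mult)
  have X2_dvd: "?N dvd (X ^ 2) ^ m - X"
  proof -
    have "(X ^ 2) ^ m - X = ?N * X"
      by (simp only: X2 power_Suc2 left_diff_distrib mult_1_left)
    then show ?thesis by (simp only: dvd_triv_left)
  qed
  have E2: "(X ^ 2 - 1) * E2 = (X ^ 2) ^ m - 1"
    unfolding power_diff_1_eq[of "X ^ 2" m]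
    by (simp add: E2_def E_def pcompose_sum pcompose_power pcompose_pCons)
  have "?N dvd (X ^ 2 - 1) * E2 - (X - 1)"
    using X2_dvd by (simp only: E2 diff_diff_eq2 diff_add_cancel)
  then have "?N dvd ((X ^ 2 - 1) * E2) ^ k - (X - 1) ^ k"
    by (rule dvd_power_diff)
  moreover have "?N dvd pcompose h ((X ^ 2) ^ m) - h"
    using diff_dvd_pcompose_diff[of "(X ^ 2) ^ m" X h] X2_dvd by (auto intro: dvd_trans)
  ultimately have "?N dvd ((X ^ 2 - 1) * E2) ^ k * pcompose h ((X ^ 2) ^ m) - (X - 1) ^ k * h"
    by (rule dvd_mult_diff)
  then have "?N dvd (X ^ (n - 1) - 1) * (((X ^ 2 - 1) * E2) ^ k * pcompose h ((X ^ 2) ^ m))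
      - (X ^ (n - 1) - 1) * ((X - 1) ^ k * h)"
    by (simp only: dvd_mult flip: right_diff_distrib)
  moreover have "?N dvd (X ^ (n - 1) - 1) * ((X - 1) ^ k * h) - (X - 1) ^ Suc k * f"
  proof -
    \<comment> \<open>Used with \<open>x = X\<close>, \<open>y = X ^ (n - 1)\<close> and
      \<open>d = (X - 1) ^ k\<close>, so that \<open>x * y\<close> is \<open>X ^ n\<close>.\<close>
    have "(y - 1) * (d * (- x * f)) - (x - 1) * d * f = (x * y - 1) * (- d * f)" for x y d
      by (simp add: algebra_simps)
    moreover have "X ^ n = X * X ^ (n - 1)" using \<open>0 < n\<close> by (simp flip: power_Suc)
    ultimately have "(X ^ (n - 1) - 1) * ((X - 1) ^ k * h) - (X - 1) ^ Suc k * f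
        = ?N * (- ((X - 1) ^ k) * f)"
      by (simp only: h_def power_Suc)
    then show ?thesis by simp
  qed
  ultimately have "?N dvd (X ^ (n - 1) - 1) * (((X ^ 2 - 1) * E2) ^ k * pcompose h ((X ^ 2) ^ m))
      - (X - 1) ^ Suc k * f"
    by (rule dvd_diff_trans)
  moreover have "pcompose ((X - 1) * 1) (X ^ (n - 1)) * pcompose ((X - 1) ^ k * g) (X ^ 2)
      = (X ^ (n - 1) - 1) * (((X ^ 2 - 1) * E2) ^ k * pcompose h ((X ^ 2) ^ m))"
  proof -
    have "pcompose (pcompose h (X ^ m)) (X ^ 2) = pcompose h ((X ^ 2) ^ m)"
      by (simp only: pcompose_power pcompose_X flip: pcompose_assoc)
    then have "pcompose ((X - 1) ^ k * g) (X ^ 2)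
        = (X ^ 2 - 1) ^ k * (E2 ^ k * pcompose h ((X ^ 2) ^ m))"
      by (simp only: g_def E2_def pcompose_mult pcompose_power pcompose_diff pcompose_1 pcompose_X)
    then show ?thesis
      by (simp only: mult_1_right pcompose_diff pcompose_1 pcompose_X power_mult_distrib mult.assoc)
  qed
  ultimately have "qring_mult (dihedral_quandle n)
      (of_poly n ((X - 1) ^ 1 * 1)) (of_poly n ((X - 1) ^ k * g)) = w"
    by (simp only: w qring_mult_of_poly[OF \<open>0 < n\<close>] power_one_right of_poly_eq_iff)
  then show ?thesis
    by (intro that[of "of_poly n ((X - 1) ^ 1 * 1)" "of_poly n ((X - 1) ^ k * g)"])
      (simp_all only: of_poly_in_cyc_power)
qed

text \<open>The products alone already fill the next \<open>cyc_power\<close>, which is a subgroup,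
  so \<open>generate\<close> adds nothing.\<close>

lemma aug_power_dihedral:
  assumes "odd n"
  shows "aug_power (dihedral_quandle n) (Suc k) = cyc_power n (Suc k)"
proof (induction k)
  case 0
  then show ?case using assms by (simp add: aug_ideal_dihedral odd_pos)
next
  case (Suc k)
  have "0 < n" using assms by (simp add: odd_pos)
  have "{qring_mult (dihedral_quandle n) u v | u v.
      u \<in> cyc_power n 1 \<and> v \<in> cyc_power n (Suc k)} = cyc_power n (Suc (Suc k))"
  proof (intro equalityI subsetI)
    fix w assume "w \<in> cyc_power n (Suc (Suc k))"
    then obtain u v where "u \<in> cyc_power n 1" "v \<in> cyc_power n (Suc k)"
        "w = qring_mult (dihedral_quandle n) u v"
      using cyc_power_Suc_product[OF assms] by metis
    then show "w \<in> {qring_mult (dihedral_quandle n) u v | u v.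
        u \<in> cyc_power n 1 \<and> v \<in> cyc_power n (Suc k)}" by blast
  qed (use qring_mult_cyc_power[OF \<open>0 < n\<close>] in blast)
  then show ?case
    using Suc subgroup_cyc_power[OF \<open>0 < n\<close>]
    by (simp add: aug_ideal_dihedral[OF \<open>0 < n\<close>] group.generateI[OF group_free_Abelian_group, symmetric])
qed

section \<open>Residues modulo \<open>n\<close> on successive quotients\<close>

text \<open>The sum of powers has the nonzero value \<open>n\<close> at 1. Each factor
  \<open>X - 1\<close> therefore divides the cofactor and can be cancelled.\<close>

lemma norm_poly_dvd_cancel:
  assumes "0 < n" "(\<Sum>i<n. X ^ i) dvd (X - 1) ^ k * f"
  shows "(\<Sum>i<n. X ^ i) dvd f"
  using assms(2)
proof (induction k)
  case (Suc k)
  then obtain h where h: "(X - 1) * ((X - 1) ^ k * f) = (\<Sum>i<n. X ^ i) * h"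
    by (auto simp: mult.assoc)
  from arg_cong[OF this, of "\<lambda>p. poly p 1"] have "poly h 1 = 0"
    using assms(1) by (simp add: poly_sum)
  then obtain h' where "h = (X - 1) * h'"
    unfolding poly_1_eq_0_iff by (elim dvdE)
  then have "(X - 1) * ((X - 1) ^ k * f) = (X - 1) * ((\<Sum>i<n. X ^ i) * h')"
    using h by (simp only: mult_ac)
  moreover have "X - 1 \<noteq> 0" by (simp add: one_pCons)
  ultimately have "(X - 1) ^ k * f = (\<Sum>i<n. X ^ i) * h'"
    by (metis mult_left_cancel)
  with Suc.IH show ?case by simp
qed simp

text \<open>Cancelling one \<open>X - 1\<close> from \<open>X ^ n - 1\<close> leaves the sum of
  powers, which must divide \<open>f\<close>; its value at 1 is \<open>n\<close>.\<close>

lemma of_poly_power_mult_eq_0: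
  assumes "0 < n" "of_poly n ((X - 1) ^ Suc k * f) = 0"
  shows "int n dvd poly f 1"
proof -
  have "(X - 1) * (\<Sum>i<n. X ^ i) dvd (X - 1) * ((X - 1) ^ k * f)"
    using assms(2) by (simp only: of_poly_eq_0_iff power_diff_1_eq power_Suc mult.assoc)
  moreover have "X - 1 \<noteq> 0" by (simp add: one_pCons)
  ultimately have "(\<Sum>i<n. X ^ i) dvd (X - 1) ^ k * f"
    by (simp only: dvd_mult_cancel_left) simp
  then obtain h where "f = (\<Sum>i<n. X ^ i) * h"
    using norm_poly_dvd_cancel[OF assms(1)] by blast
  then show ?thesis by (simp add: poly_sum)
qed

lemma of_poly_power_mult_in_iff:
  assumes "0 < n"
  shows "of_poly n ((X - 1) ^ Suc k * f) \<in> cyc_power n (Suc (Suc k)) \<longleftrightarrow> int n dvd poly f 1"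
proof
  assume "of_poly n ((X - 1) ^ Suc k * f) \<in> cyc_power n (Suc (Suc k))"
  then obtain g where "of_poly n ((X - 1) ^ Suc k * f) = of_poly n ((X - 1) ^ Suc (Suc k) * g)"
    by (auto simp only: cyc_power_def)
  moreover have "(X - 1) ^ Suc k * (f - (X - 1) * g)
      = (X - 1) ^ Suc k * f - (X - 1) ^ Suc (Suc k) * g"
    by (simp add: algebra_simps)
  ultimately have "of_poly n ((X - 1) ^ Suc k * (f - (X - 1) * g)) = 0"
    by (simp only: of_poly_diff diff_self)
  from of_poly_power_mult_eq_0[OF assms this] show "int n dvd poly f 1" by simp
next
  assume "int n dvd poly f 1"
  then obtain c where c: "poly f 1 = int n * c" by blast
  let ?S = "\<Sum>i<n. X ^ i"
  \<comment> \<open>Since \<open>?S\<close> has value \<open>n\<close> at 1, subtracting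
    \<open>c\<close> copies of it makes \<open>f\<close> vanish there. The correction is harmless
    because \<open>(X - 1) * ?S\<close> is \<open>X ^ n - 1\<close>.\<close>
  have "poly (f - smult c ?S) 1 = 0" by (simp add: c poly_sum)
  then obtain g where "f - smult c ?S = (X - 1) * g"
    unfolding poly_1_eq_0_iff by (elim dvdE)
  then have g: "f - (X - 1) * g = smult c ?S" by (metis add_diff_cancel_left' diff_add_cancel)
  have "(X - 1) ^ Suc k * f - (X - 1) ^ Suc (Suc k) * g
      = (X - 1) ^ Suc k * (f - (X - 1) * g)"
    by (simp add: algebra_simps)
  also have "\<dots> = (X - 1) * ?S * smult c ((X - 1) ^ k)"
    unfolding g by (simp add: mult_ac)
  finally have "(X - 1) ^ Suc k * f - (X - 1) ^ Suc (Suc k) * g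
      = (X - 1) * ?S * smult c ((X - 1) ^ k)" .
  then have "of_poly n ((X - 1) ^ Suc k * f) = of_poly n ((X - 1) ^ Suc (Suc k) * g)"
    unfolding of_poly_eq_iff power_diff_1_eq by (simp only: dvd_triv_left)
  then show "of_poly n ((X - 1) ^ Suc k * f) \<in> cyc_power n (Suc (Suc k))"
    by (simp only: of_poly_in_cyc_power)
qed

text \<open>The cofactor \<open>f\<close> is not determined by \<open>u\<close>, so one is chosen.
  For positive \<open>n\<close> and \<open>k\<close>, two choices agree at 1 modulo \<open>n\<close>
  by \<open>of_poly_power_mult_eq_0\<close>.\<close>

definition cyc_residue :: "nat \<Rightarrow> nat \<Rightarrow> (int \<Rightarrow>\<^sub>0 int) \<Rightarrow> int" where
  "cyc_residue n k u = poly (SOME f. u = of_poly n ((X - 1) ^ k * f)) 1 mod int n"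

lemma cyc_residue_of_poly:
  assumes "0 < n"
  shows "cyc_residue n (Suc k) (of_poly n ((X - 1) ^ Suc k * f)) = poly f 1 mod int n"
proof -
  let ?u = "of_poly n ((X - 1) ^ Suc k * f)"
  define g where "g = (SOME g. ?u = of_poly n ((X - 1) ^ Suc k * g))"
  have "?u = of_poly n ((X - 1) ^ Suc k * g)"
    unfolding g_def by (rule someI[of _ f]) (rule refl)
  then have "of_poly n ((X - 1) ^ Suc k * (g - f)) = 0"
    by (simp only: of_poly_diff right_diff_distrib diff_self)
  from of_poly_power_mult_eq_0[OF assms this] show ?thesis
    by (simp add: cyc_residue_def g_def[symmetric] mod_eq_dvd_iff del: power_Suc)
qed

theorem theorem6p2:
  fixes n k :: nat
  assumes "0 < n" and "odd n" and "1 \<le> k"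
  shows "aug_quotient (dihedral_quandle n) k \<cong> integer_mod_group n"
proof -
  obtain l where k: "k = Suc l" using assms(3) by (cases k) auto
  let ?G = "(free_Abelian_group {0..<int n})\<lparr>carrier := cyc_power n k\<rparr>"
  let ?h = "cyc_residue n k"
  have h: "?h (of_poly n ((X - 1) ^ k * f)) = poly f 1 mod int n" for f
    unfolding k by (rule cyc_residue_of_poly[OF assms(1)])
  have "group ?G"
    using subgroup_cyc_power[OF assms(1)] by (simp add: subgroup.subgroup_is_group)
  moreover have "?h \<in> hom ?G (integer_mod_group n)"
  proof (rule homI)
    fix u assume "u \<in> carrier ?G"
    then show "?h u \<in> carrier (integer_mod_group n)"
      using assms(1) by (auto simp: cyc_power_def h carrier_integer_mod_group)
  next
    fix u v assume "u \<in> carrier ?G" "v \<in> carrier ?G"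
    then obtain f g where u: "u = of_poly n ((X - 1) ^ k * f)" and v: "v = of_poly n ((X - 1) ^ k * g)"
      by (auto simp: cyc_power_def)
    then have "u + v = of_poly n ((X - 1) ^ k * (f + g))"
      by (simp add: of_poly_add distrib_left)
    then show "?h (u \<otimes>\<^bsub>?G\<^esub> v) = ?h u \<otimes>\<^bsub>integer_mod_group n\<^esub> ?h v"
      by (simp add: h mod_add_eq) (simp add: u v h mod_add_eq)
  qed
  ultimately interpret group_hom ?G "integer_mod_group n" ?h
    by (simp add: group_hom_def group_hom_axioms_def)
  have "?h ` carrier ?G = carrier (integer_mod_group n)"
  proof (intro equalityI subsetI)
    fix c assume "c \<in> carrier (integer_mod_group n)"
    \<comment> \<open>A constant cofactor realizes any prescribed residue.\<close>
    then have "?h (of_poly n ((X - 1) ^ k * [:c:])) = c"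
      using assms(1) by (simp only: h) (simp add: carrier_integer_mod_group)
    then show "c \<in> ?h ` carrier ?G"
      by (intro image_eqI[where x = "of_poly n ((X - 1) ^ k * [:c:])"])
        (simp_all add: of_poly_in_cyc_power del: mult_pCons_right)
  qed (use hom_closed in blast)
  then have "?G Mod kernel ?G (integer_mod_group n) ?h \<cong> integer_mod_group n"
    by (rule FactGroup_iso)
  moreover have "kernel ?G (integer_mod_group n) ?h = cyc_power n (Suc k)"
  proof -
    \<comment> \<open>The kernel is taken inside \<open>cyc_power n k\<close>, so equality also
      needs this inclusion.\<close>
    have "cyc_power n (Suc k) \<subseteq> cyc_power n k"
      unfolding cyc_power_def power_Suc2 mult.assoc by blast
    moreover have "?h u = 0 \<longleftrightarrow> u \<in> cyc_power n (Suc k)" if "u \<in> cyc_power n k" for u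
    proof -
      obtain f where "u = of_poly n ((X - 1) ^ k * f)"
        using \<open>u \<in> cyc_power n k\<close> by (auto simp: cyc_power_def)
      then show ?thesis
        using of_poly_power_mult_in_iff[OF assms(1), of l f, folded k]
        by (simp only: h mod_eq_0_iff_dvd)
    qed
    ultimately show ?thesis by (auto simp: kernel_def)
  qed
  ultimately show ?thesis
    by (simp only: aug_quotient_def k aug_power_dihedral[OF assms(2)] carrier_dihedral)
qed

end
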